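(* There exist $\alpha_0 > 0$ and, for each $\epsilon > 0$, a constant $c_\epsilon > 0$ depending only on $\epsilon$, such that for every $\alpha$ with $0 < \alpha < \alpha_0$ there exist an integer $n \ge 1$ and $n$-tuples $x = (x_1, \ldots, x_n)$ and $y = (y_1, \ldots, y_n)$ of distinct points of $[0,1]$ satisfying: (i) $\delta_H(x,[0,1]) \leq \alpha$; (ii) $x$ and $y$ are weakly isotonic; (iii) for every similarity $A$ of $\mathbb{R}$ and every $\epsilon > 0$, $d_\infty(x, Ay) \ge c_\epsilon\, \alpha^{1+\epsilon}$.
   Context: All distances are the usual distance on $\mathbb{R}$. An $n$-tuple of distinct points is also regarded as a finite set. Weakly isotonic: $n$-tuples $x=(x_1,\ldots,x_n)$ and $y=(y_1,\ldots,y_n)$ are weakly isotonic if for all $i,j,k \in \{1,\ldots,n\}$ one has $|x_i - x_j| < |x_i - x_k|$ if and only if $|y_i - y_j| < |y_i - y_k|$. $\delta_H(x,[0,1])$ is the smallest $a$ such that every point of $[0,1]$ is within distance $a$ of some point $x_i$. A similarity of $\mathbb{R}$ is a homeomorphism $A:\mathbb{R}\to\mathbb{R}$ that multiplies all distances by a (positive) scalar, i.e. a map $z \mapsto \lambda z + b$ with $\lambda \neq 0$. $Ay$ denotes $(Ay_1,\ldots,Ay_n)$. $d_\infty(x,z) = \max_{1\le i\le n} |x_i - z_i|$. *)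

theory Defs
  imports "HOL-Analysis.Analysis"
begin

text \<open>
  An \<open>n\<close>-tuple of reals is a function \<open>x :: nat \<Rightarrow> real\<close> of which only the values at the
  indices \<open>1, \<dots>, n\<close> matter.
\<close>

definition distinct_tuple_in :: "nat \<Rightarrow> real set \<Rightarrow> (nat \<Rightarrow> real) \<Rightarrow> bool" where
  "distinct_tuple_in n S x \<longleftrightarrow> inj_on x {1..n} \<and> x ` {1..n} \<subseteq> S"

definition weakly_isotonic :: "nat \<Rightarrow> (nat \<Rightarrow> real) \<Rightarrow> (nat \<Rightarrow> real) \<Rightarrow> bool" where
  "weakly_isotonic n x y \<longleftrightarrow>
     (\<forall>i\<in>{1..n}. \<forall>j\<in>{1..n}. \<forall>k\<in>{1..n}.
        \<bar>x i - x j\<bar> < \<bar>x i - x k\<bar> \<longleftrightarrow> \<bar>y i - y j\<bar> < \<bar>y i - y k\<bar>)"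

text \<open>
  The one-sided Hausdorff distance from \<open>S\<close> to a finite set \<open>X\<close>. The least element exists when
  \<open>X\<close> is finite and nonempty and \<open>S\<close> is compact and nonempty; see \<open>delta_H_le_iff\<close> below.
\<close>

definition delta_H :: "real set \<Rightarrow> real set \<Rightarrow> real" where
  "delta_H X S = (LEAST a. \<forall>t\<in>S. \<exists>p\<in>X. dist t p \<le> a)"

definition similarity :: "(real \<Rightarrow> real) \<Rightarrow> bool" where
  "similarity A \<longleftrightarrow>
     (\<exists>B. homeomorphism UNIV UNIV A B) \<and>
     (\<exists>r>0. \<forall>s t. dist (A s) (A t) = r * dist s t)"

definition d_infty :: "nat \<Rightarrow> (nat \<Rightarrow> real) \<Rightarrow> (nat \<Rightarrow> real) \<Rightarrow> real" where
  "d_infty n x z = Max ((\<lambda>i. \<bar>x i - z i\<bar>) ` {1..n})"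

lemma delta_H_le_iff:
  assumes "finite X" "X \<noteq> {}" "compact S" "S \<noteq> {}"
  shows "delta_H X S \<le> a \<longleftrightarrow> (\<forall>t\<in>S. \<exists>p\<in>X. dist t p \<le> a)"
proof -
  have iff: "(\<exists>p\<in>X. dist t p \<le> b) \<longleftrightarrow> infdist t X \<le> b" for t b
  proof
    assume "\<exists>p\<in>X. dist t p \<le> b"
    then show "infdist t X \<le> b"
      using infdist_le2 by blast
  next
    assume b: "infdist t X \<le> b"
    obtain p where "p \<in> X" "infdist t X = dist t p"
      using infdist_attains_inf[of X t] assms finite_imp_closed by blast
    with b show "\<exists>p\<in>X. dist t p \<le> b" by auto
  qed
  obtain s where s: "s \<in> S" "\<And>t. t \<in> S \<Longrightarrow> infdist t X \<le> infdist s X"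
    using continuous_attains_sup[OF assms(3,4), of "\<lambda>t. infdist t X"]
    using continuous_on_infdist[OF continuous_on_id, of S X] by auto
  have "delta_H X S = infdist s X"
    unfolding delta_H_def iff by (rule Least_equality) (use s in auto)
  then show ?thesis
    unfolding iff using s by (metis order_trans)
qed

lemma similarity_iff_affine:
  "similarity A \<longleftrightarrow> (\<exists>l b. l \<noteq> 0 \<and> A = (\<lambda>z. l * z + b))"
proof
  assume "similarity A"
  then obtain r where r: "r > 0" "\<And>s t. \<bar>A s - A t\<bar> = r * \<bar>s - t\<bar>"
    by (auto simp: similarity_def dist_real_def)
  define l where "l = A 1 - A 0"
  have l: "\<bar>l\<bar> = r" using r(2)[of 1 0] by (simp add: l_def)
  have "A z = l * z + A 0" for z
  proof -
    define u where "u = A z - A 0"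
    have abs_u: "\<bar>u\<bar> = \<bar>l * z\<bar>"
      using r(2)[of z 0] l by (simp add: u_def abs_mult)
    have "u - l = A z - A 1" "l * z - l = l * (z - 1)"
      by (simp_all add: u_def l_def right_diff_distrib)
    then have abs_ul: "\<bar>u - l\<bar> = \<bar>l * z - l\<bar>"
      using r(2)[of z 1] l by (simp add: abs_mult)
    have sq: "u\<^sup>2 = (l * z)\<^sup>2" "(u - l)\<^sup>2 = (l * z - l)\<^sup>2"
      using abs_u abs_ul by (metis power2_abs)+
    have "2 * (l * (u - l * z)) = (u\<^sup>2 - (l * z)\<^sup>2) - ((u - l)\<^sup>2 - (l * z - l)\<^sup>2)"
      by (simp add: power2_eq_square algebra_simps)
    then have "l * (u - l * z) = 0" using sq by simp
    moreover have "l \<noteq> 0" using l r(1) by auto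
    ultimately have "u = l * z" by simp
    then show ?thesis by (simp add: u_def)
  qed
  then have "A = (\<lambda>z. l * z + A 0)" by (rule ext)
  moreover have "l \<noteq> 0" using l r(1) by auto
  ultimately show "\<exists>l b. l \<noteq> 0 \<and> A = (\<lambda>z. l * z + b)" by blast
next
  assume "\<exists>l b. l \<noteq> 0 \<and> A = (\<lambda>z. l * z + b)"
  then obtain l b where lb: "l \<noteq> 0" and A: "A = (\<lambda>z. l * z + b)" by blast
  have "homeomorphism UNIV UNIV A (\<lambda>z. (z - b) / l)"
    unfolding homeomorphism_def A
  proof (intro conjI ballI)
    show "range (\<lambda>z. l * z + b) = UNIV"
      by (rule surjI[of _ "\<lambda>z. (z - b) / l"]) (use lb in simp)
    show "range (\<lambda>z. (z - b) / l) = UNIV"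
      by (rule surjI[of _ "\<lambda>z. l * z + b"]) (use lb in simp)
    show "continuous_on UNIV (\<lambda>z. (z - b) / l)" "continuous_on UNIV (\<lambda>z. l * z + b)"
      using lb by (intro continuous_intros; simp)+
  qed (use lb in simp_all)
  moreover have "dist (A s) (A t) = \<bar>l\<bar> * dist s t" for s t
    using abs_mult[of l "s - t"] by (simp add: A dist_real_def right_diff_distrib)
  moreover have "\<bar>l\<bar> > 0" using lb by simp
  ultimately show "similarity A"
    unfolding similarity_def by blast
qed

end

theory Submission
  imports Defs
begin

text \<open>
  Take integers \<open>X 0 < \<dots> < X (M - 1)\<close> without three-term arithmetic progressions. No two
  distances from a common point are then equal, so they differ by at least 1, and moving one point
  by less than \<open>1/2\<close> preserves weak isotony, whereas no affine map undoes the move if the point is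
  an inner one. Rescaling by the length \<open>N\<close> of the range gives a lower bound of order \<open>1 / N\<close>.

  For the covering radius we need the progression-free set to meet every interval of length
  \<open>L = N / M\<close> with \<open>L\<close> subpolynomial in \<open>M\<close>. We put one point \<open>n L + a n\<close> in each interval, where
  \<open>a n < L / 2\<close> is a Behrend-type colour of \<open>n\<close>: in base \<open>2 e\<close> it records which digits of \<open>n\<close> are
  at least \<open>e\<close>, as a ternary number with digits 0 and 1, and the sum of the squares of the digits
  modulo \<open>e\<close>. If \<open>j\<close>, \<open>i\<close>, \<open>k\<close> and their colours are in progression, then the ternary parts agree,
  hence there are no carries in \<open>j + k = 2 i\<close>, and strict convexity of the squares forces \<open>j = k\<close>.
\<close>

text \<open>Applied with bases \<open>3\<close>, \<open>2 * e\<close>, \<open>B\<close> and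
  \<open>L\<close>: once carries are excluded, an equation between sums splits into one for the
  quotients and one for the remainders.\<close>

lemma mult_add_eq_iff:
  fixes a a' b b' B :: nat
  assumes "b < B" "b' < B"
  shows "a * B + b = a' * B + b' \<longleftrightarrow> a = a' \<and> b = b'"
proof
  assume eq: "a * B + b = a' * B + b'"
  have "(a * B + b) div B = a" "(a' * B + b') div B = a'"
    using assms by auto
  with eq show "a = a' \<and> b = b'" by auto
qed auto

subsection \<open>A colouring without monotone progressions\<close>

text \<open>The bits are written in base 3 so that adding two such numbers, or doubling one,
  produces digits at most 2 and hence no carry.\<close>

primrec upper_digits :: "nat \<Rightarrow> nat \<Rightarrow> nat \<Rightarrow> nat" where
  "upper_digits e 0 n = 0"
| "upper_digits e (Suc m) n = 3 * upper_digits e m (n div (2 * e)) + (n div e) mod 2"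

primrec digit_squares :: "nat \<Rightarrow> nat \<Rightarrow> nat \<Rightarrow> nat" where
  "digit_squares e 0 n = 0"
| "digit_squares e (Suc m) n = digit_squares e m (n div (2 * e)) + (n mod e)\<^sup>2"

lemma upper_digits_less: "upper_digits e m n < 3 ^ m"
proof (induction m arbitrary: n)
  case (Suc m)
  have "(n div e) mod 2 < 2" by simp
  with Suc[of "n div (2 * e)"] show ?case
    unfolding upper_digits.simps power_Suc by linarith
qed simp

lemma digit_squares_le:
  assumes "e > 0"
  shows "digit_squares e m n \<le> m * e\<^sup>2"
proof (induction m arbitrary: n)
  case (Suc m)
  have "(n mod e)\<^sup>2 \<le> e\<^sup>2"
    using assms by (intro power_mono) (simp_all add: less_imp_le)
  with Suc[of "n div (2 * e)"] show ?case
    unfolding digit_squares.simps mult_Suc by linarith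
qed simp

text \<open>The two sides differ by \<open>2 * (a - b)\<^sup>2\<close>, computed over
  \<open>int\<close> because subtraction on \<open>nat\<close> truncates.\<close>

lemma sum_squares_ge_midpoint:
  fixes a b c :: nat
  assumes "b + c = 2 * a"
  shows "2 * a\<^sup>2 \<le> b\<^sup>2 + c\<^sup>2" and "b\<^sup>2 + c\<^sup>2 = 2 * a\<^sup>2 \<Longrightarrow> b = c"
proof -
  have c: "int c = 2 * int a - int b"
    using assms by linarith
  have "int (b\<^sup>2 + c\<^sup>2) = int (2 * a\<^sup>2) + 2 * (int a - int b)\<^sup>2"
    by (simp add: c power2_eq_square algebra_simps)
  moreover have "(int a - int b)\<^sup>2 \<ge> 0" by simp
  ultimately show "2 * a\<^sup>2 \<le> b\<^sup>2 + c\<^sup>2" and "b\<^sup>2 + c\<^sup>2 = 2 * a\<^sup>2 \<Longrightarrow> b = c"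
    using assms by (linarith, simp)
qed

text \<open>Induction on the number of digits, splitting off the lowest one. The inequality is
  carried along for the equality case: when two inequalities add up to an equality, each of them is
  an equality.\<close>

lemma digit_squares_midpoint:
  assumes "e > 0" and "i < (2 * e) ^ m" "j < (2 * e) ^ m" "k < (2 * e) ^ m"
    and "j + k = 2 * i"
    and "upper_digits e m j + upper_digits e m k = 2 * upper_digits e m i"
  shows "2 * digit_squares e m i \<le> digit_squares e m j + digit_squares e m k \<and>
    (digit_squares e m j + digit_squares e m k = 2 * digit_squares e m i \<longrightarrow> j = k)"
  using assms(2-)
proof (induction m arbitrary: i j k)
  case (Suc m)
  define h q s where "h n = (n div e) mod 2" and "q n = n div (2 * e)" and "s n = n mod e" for n
  have split: "n = q n * (2 * e) + (h n * e + s n)" for n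
  proof -
    have "n = n div e * e + s n" by (simp add: s_def)
    also have "n div e = 2 * q n + h n"
      by (simp add: q_def h_def div_mult2_eq mult.commute[of 2])
    finally show ?thesis by (simp add: algebra_simps)
  qed
  have h: "h n < 2" and s: "s n < e" for n
    using \<open>e > 0\<close> by (simp_all add: h_def s_def)
  have q: "q n < (2 * e) ^ m" if "n < (2 * e) ^ Suc m" for n
    using that by (simp add: q_def less_mult_imp_div_less mult.commute)
  let ?U = "upper_digits e m"
  have "(?U (q j) + ?U (q k)) * 3 + (h j + h k) = (2 * ?U (q i)) * 3 + 2 * h i"
    using Suc.prems(5) by (simp add: h_def q_def)
  then have U: "?U (q j) + ?U (q k) = 2 * ?U (q i)" and hh: "h j + h k = 2 * h i"
    using mult_add_eq_iff[of "h j + h k" 3 "2 * h i" "?U (q j) + ?U (q k)" "2 * ?U (q i)"]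
      h[of i] h[of j] h[of k] by linarith+
  \<comment> \<open>Two bits with an even sum coincide. The multiples of \<open>e\<close> then
    cancel, and the remaining \<open>s j + s k\<close> and \<open>2 * s i\<close> are below
    \<open>2 * e\<close>, so nothing is carried into the quotients.\<close>
  have "h j = h i" "h k = h i"
    using hh h[of i] h[of j] h[of k] by linarith+
  with split[of i] split[of j] split[of k] Suc.prems(4)
  have "(q j + q k) * (2 * e) + (s j + s k) = (2 * q i) * (2 * e) + 2 * s i"
    by (simp add: algebra_simps)
  then have qq: "q j + q k = 2 * q i" and ss: "s j + s k = 2 * s i"
    using mult_add_eq_iff[of "s j + s k" "2 * e" "2 * s i" "q j + q k" "2 * q i"]
      s[of i] s[of j] s[of k] by linarith+
  note IH = Suc.IH[OF q[OF Suc.prems(1)] q[OF Suc.prems(2)] q[OF Suc.prems(3)] qq U]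
  note sq = sum_squares_ge_midpoint[OF ss]
  have Q: "digit_squares e (Suc m) n = digit_squares e m (q n) + (s n)\<^sup>2" for n
    by (simp add: q_def s_def)
  show ?case
  proof (intro conjI impI)
    show "2 * digit_squares e (Suc m) i \<le> digit_squares e (Suc m) j + digit_squares e (Suc m) k"
      unfolding Q using add_mono[OF conjunct1[OF IH] sq(1)] by simp
    assume "digit_squares e (Suc m) j + digit_squares e (Suc m) k = 2 * digit_squares e (Suc m) i"
    then have "digit_squares e m (q j) + digit_squares e m (q k) = 2 * digit_squares e m (q i)"
        and "(s j)\<^sup>2 + (s k)\<^sup>2 = 2 * (s i)\<^sup>2"
      unfolding Q using conjunct1[OF IH] sq(1) by simp_all
    then have "q j = q k" "s j = s k" using IH sq(2) by auto
    then show "j = k"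
      using split[of j] split[of k] \<open>h j = h i\<close> \<open>h k = h i\<close> by simp
  qed
qed simp

lemma midpoint_free_sequence:
  fixes e m :: nat
  assumes "e > 0"
  defines "L \<equiv> 2 * (3 ^ m * (2 * m * e\<^sup>2 + 1))"
  obtains X :: "nat \<Rightarrow> nat"
  where "\<And>n. n * L \<le> X n" "\<And>n. X n < Suc n * L"
    and "\<And>i j k. \<lbrakk>i < (2 * e) ^ m; j < (2 * e) ^ m; k < (2 * e) ^ m; X j + X k = 2 * X i\<rbrakk>
      \<Longrightarrow> j = k"
proof -
  \<comment> \<open>\<open>B\<close> exceeds twice any digit-square sum, and the leading factor 2 in
    \<open>L\<close> puts twice any colour below \<open>L\<close>. Sums of two colours can therefore
    be compared componentwise.\<close>
  define B where "B = 2 * m * e\<^sup>2 + 1"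
  define a where "a n = upper_digits e m n * B + digit_squares e m n" for n
  have sq: "2 * digit_squares e m n < B" for n
    using digit_squares_le[OF \<open>e > 0\<close>, of m n] by (simp add: B_def)
  have a: "2 * a n < L" for n
  proof -
    have "a n < Suc (upper_digits e m n) * B"
      using sq[of n] by (simp add: a_def)
    also have "\<dots> \<le> 3 ^ m * B"
      using upper_digits_less[of e m n] by (intro mult_right_mono) auto
    finally show ?thesis by (simp add: L_def B_def)
  qed
  show thesis
  proof (rule that[of "\<lambda>n. n * L + a n"])
    show "n * L + a n < Suc n * L" for n
      using a[of n] by simp
  next
    fix i j k
    assume less: "i < (2 * e) ^ m" "j < (2 * e) ^ m" "k < (2 * e) ^ m"
      and "j * L + a j + (k * L + a k) = 2 * (i * L + a i)"
    then have "(j + k) * L + (a j + a k) = (2 * i) * L + 2 * a i"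
      by (simp add: algebra_simps)
    then have jk: "j + k = 2 * i" and "a j + a k = 2 * a i"
      using mult_add_eq_iff[of "a j + a k" L "2 * a i"] a[of i] a[of j] a[of k] by auto
    then have "(upper_digits e m j + upper_digits e m k) * B
          + (digit_squares e m j + digit_squares e m k)
        = (2 * upper_digits e m i) * B + 2 * digit_squares e m i"
      by (simp add: a_def algebra_simps)
    then have "upper_digits e m j + upper_digits e m k = 2 * upper_digits e m i"
      and "digit_squares e m j + digit_squares e m k = 2 * digit_squares e m i"
      using mult_add_eq_iff[of "digit_squares e m j + digit_squares e m k" B
          "2 * digit_squares e m i"] sq[of i] sq[of j] sq[of k] by auto
    then show "j = k"
      using digit_squares_midpoint[OF \<open>e > 0\<close> less jk] by blast
  qed simp
qed

subsection \<open>From progression-free integers to weakly isotonic tuples\<close>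

lemma weakly_isotonic_perturbation:
  fixes X :: "nat \<Rightarrow> nat" and Y :: "nat \<Rightarrow> real"
  assumes inj: "inj_on X I"
    and free: "\<And>i j k. \<lbrakk>i \<in> I; j \<in> I; k \<in> I; X j + X k = 2 * X i\<rbrakk> \<Longrightarrow> j = k"
    and close: "\<And>i. i \<in> I \<Longrightarrow> \<bar>Y i - X i\<bar> \<le> 1/8"
    and I: "i \<in> I" "j \<in> I" "k \<in> I"
  shows "\<bar>real (X i) - X j\<bar> < \<bar>real (X i) - X k\<bar> \<longleftrightarrow> \<bar>Y i - Y j\<bar> < \<bar>Y i - Y k\<bar>"
proof (cases "j = k")
  case False
  define u v where "u = \<bar>int (X i) - int (X j)\<bar>" and "v = \<bar>int (X i) - int (X k)\<bar>"
  have "X j \<noteq> X k" using False inj I by (auto dest: inj_onD)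
  moreover have "X j + X k \<noteq> 2 * X i" using False free I by blast
  ultimately have "u \<noteq> v" by (auto simp: u_def v_def abs_eq_iff)
  then have "real_of_int u + 1 \<le> v \<or> real_of_int v + 1 \<le> u" by linarith
  then have "\<bar>real (X i) - X j\<bar> + 1 \<le> \<bar>real (X i) - X k\<bar> \<or>
      \<bar>real (X i) - X k\<bar> + 1 \<le> \<bar>real (X i) - X j\<bar>"
    by (simp add: u_def v_def)
  \<comment> \<open>Each distance changes by at most 1/4, so the difference of two distances changes
    by at most 1/2, less than the gap 1.\<close>
  moreover have dist: "\<bar>\<bar>Y i - Y p\<bar> - \<bar>real (X i) - X p\<bar>\<bar> \<le> 1/4" if "p \<in> I" for p
  proof (rule order_trans[OF abs_triangle_ineq3])
    show "\<bar>(Y i - Y p) - (real (X i) - X p)\<bar> \<le> 1/4"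
      using close[OF I(1)] close[OF that] by linarith
  qed
  note dist[OF I(2)] dist[OF I(3)]
  ultimately show ?thesis
    unfolding abs_le_iff[of "_ - _" "1/4"] by argo
qed simp

lemma affine_abs_le_between:
  fixes p q r :: real
  assumes "p \<le> q" "q \<le> r" "\<bar>s * p + t\<bar> \<le> D" "\<bar>s * r + t\<bar> \<le> D"
  shows "\<bar>s * q + t\<bar> \<le> D"
proof (cases "s \<ge> 0")
  case True
  then have "s * p \<le> s * q" "s * q \<le> s * r"
    using assms by (simp_all add: mult_left_mono)
  with assms show ?thesis by linarith
next
  case False
  then have "s * q \<le> s * p" "s * r \<le> s * q"
    using assms by (simp_all add: mult_left_mono_neg)
  with assms show ?thesis by linarith
qed

text \<open>The discrepancy \<open>(1 - l) * z - b\<close> has modulus at most \<open>D\<close> at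
  the fixed points \<open>y i\<close> and \<open>y k\<close>, hence also at \<open>y j\<close>
  between them. The error at \<open>j\<close> is this discrepancy minus the displacement
  \<open>y j - x j\<close>, so the displacement is at most \<open>2 * D\<close>.\<close>

lemma d_infty_affine_ge:
  assumes ijk: "i \<in> {1..n}" "j \<in> {1..n}" "k \<in> {1..n}"
    and "y i = x i" "y k = x k" "y i \<le> y j" "y j \<le> y k"
  shows "d_infty n x (\<lambda>i. l * y i + b) \<ge> \<bar>y j - x j\<bar> / 2"
proof -
  define D where "D = d_infty n x (\<lambda>i. l * y i + b)"
  have le: "\<bar>x m - (l * y m + b)\<bar> \<le> D" if "m \<in> {1..n}" for m
    unfolding D_def d_infty_def using that by (intro Max_ge) auto
  define g where "g = (1 - l) * y j + (- b)"
  have "\<bar>g\<bar> \<le> D"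
    unfolding g_def
  proof (rule affine_abs_le_between)
    show "\<bar>(1 - l) * y i + (- b)\<bar> \<le> D" "\<bar>(1 - l) * y k + (- b)\<bar> \<le> D"
      using le[OF ijk(1)] le[OF ijk(3)] assms(4,5) by (simp_all add: algebra_simps)
  qed (use assms in auto)
  moreover have "x j - (l * y j + b) = g - (y j - x j)"
    by (simp add: g_def algebra_simps)
  then have "\<bar>g - (y j - x j)\<bar> \<le> D"
    using le[OF ijk(2)] by simp
  ultimately have "\<bar>y j - x j\<bar> \<le> D + D" by linarith
  then show ?thesis by (simp add: D_def)
qed

lemma exists_nonsimilar_weakly_isotonic_tuples:
  fixes X :: "nat \<Rightarrow> nat" and M L :: nat
  assumes "M \<ge> 3"
    and lower: "\<And>n. n * L \<le> X n" and upper: "\<And>n. X n < Suc n * L"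
    and free: "\<And>i j k. \<lbrakk>i < M; j < M; k < M; X j + X k = 2 * X i\<rbrakk> \<Longrightarrow> j = k"
  obtains x y :: "nat \<Rightarrow> real"
  where "distinct_tuple_in M {0..1} x" "distinct_tuple_in M {0..1} y"
    "delta_H (x ` {1..M}) {0..1} \<le> 1 / M" "weakly_isotonic M x y"
    "\<And>A. similarity A \<Longrightarrow> d_infty M x (\<lambda>i. A (y i)) \<ge> 1 / (16 * (real M * L))"
proof -
  define N :: real where "N = real M * L"
  \<comment> \<open>Tuples are indexed from 1, the sequence \<open>X\<close> from 0. Only the point
    with index 2 is moved; it is an inner one since \<open>M\<close> is at least 3. Its shift 1/8,
    halved by \<open>d_infty_affine_ge\<close>, gives the constant 16.\<close>
  define Z where "Z i = X (i - 1)" for i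
  define Y :: "nat \<Rightarrow> real" where "Y i = Z i + (if i = 2 then 1/8 else 0)" for i
  define x y where "x i = Z i / N" and "y i = Y i / N" for i
  have "L > 0" using upper[of 0] by simp
  then have N: "N > 0" using \<open>M \<ge> 3\<close> by (simp add: N_def)
  have mono: "X i < X j" if "i < j" for i j
  proof -
    have "X i < Suc i * L" by (rule upper)
    also have "\<dots> \<le> j * L" using that by (intro mult_right_mono) auto
    also have "\<dots> \<le> X j" by (rule lower)
    finally show ?thesis .
  qed
  have Z_mono: "Z i < Z j" if "i \<in> {1..M}" "j \<in> {1..M}" "i < j" for i j
    using that by (auto simp: Z_def intro!: mono)
  have inj: "inj_on Z {1..M}"
    using Z_mono by (metis inj_onI nat_neq_iff)
  have Z_free: "j = k" if "i \<in> {1..M}" "j \<in> {1..M}" "k \<in> {1..M}" "Z j + Z k = 2 * Z i" for i j k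
  proof -
    have "i - 1 < M" "j - 1 < M" "k - 1 < M"
      using that by auto
    then have "j - 1 = k - 1"
      using free that(4) unfolding Z_def by blast
    with that(2,3) show ?thesis by auto
  qed
  have close: "\<bar>Y i - Z i\<bar> \<le> 1/8" for i
    by (simp add: Y_def)
  \<comment> \<open>The spare unit keeps the shifted point inside the unit interval after
    rescaling.\<close>
  have Z_less: "Z i + 1 \<le> N" if "i \<in> {1..M}" for i
  proof -
    have "Z i < Suc (i - 1) * L" unfolding Z_def by (rule upper)
    also have "\<dots> \<le> M * L" using that by (intro mult_right_mono) auto
    finally have "real (Z i + 1) \<le> real (M * L)" by (simp only: of_nat_le_iff)
    then show ?thesis by (simp add: N_def)
  qed
  have Y_inj: "i = j" if "i \<in> {1..M}" "j \<in> {1..M}" "Y i = Y j" for i j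
  proof (rule ccontr)
    assume "i \<noteq> j"
    then have "Z i \<noteq> Z j" using inj that by (auto dest: inj_onD)
    with close[of i] close[of j] that show False by linarith
  qed
  show thesis
  proof (rule that[of x y])
    show "distinct_tuple_in M {0..1} x"
      unfolding distinct_tuple_in_def
    proof
      show "inj_on x {1..M}"
      proof (rule inj_onI)
        fix i j assume I: "i \<in> {1..M}" "j \<in> {1..M}" and "x i = x j"
        then have "Z i = Z j" using N by (simp add: x_def)
        then show "i = j" using inj I by (blast dest: inj_onD)
      qed
      show "x ` {1..M} \<subseteq> {0..1}"
      proof
        fix p assume "p \<in> x ` {1..M}"
        then obtain i where "i \<in> {1..M}" "p = x i" by blast
        with Z_less[of i] N show "p \<in> {0..1}" by (auto simp: x_def)
      qed
    qed
    show "distinct_tuple_in M {0..1} y"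
      unfolding distinct_tuple_in_def
    proof
      show "inj_on y {1..M}"
      proof (rule inj_onI)
        fix i j assume I: "i \<in> {1..M}" "j \<in> {1..M}" and "y i = y j"
        then have "Y i = Y j" using N by (simp add: y_def)
        then show "i = j" using Y_inj I by blast
      qed
      show "y ` {1..M} \<subseteq> {0..1}"
      proof
        fix p assume "p \<in> y ` {1..M}"
        then obtain i where "i \<in> {1..M}" "p = y i" by blast
        with Z_less[of i] N show "p \<in> {0..1}" by (auto simp: y_def Y_def)
      qed
    qed
    show "weakly_isotonic M x y"
      unfolding weakly_isotonic_def
    proof (intro ballI)
      fix i j k assume I: "i \<in> {1..M}" "j \<in> {1..M}" "k \<in> {1..M}"
      have "\<bar>x p - x q\<bar> = \<bar>real (Z p) - Z q\<bar> / N" "\<bar>y p - y q\<bar> = \<bar>Y p - Y q\<bar> / N" for p q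
        using N by (simp_all add: x_def y_def flip: diff_divide_distrib)
      then show "\<bar>x i - x j\<bar> < \<bar>x i - x k\<bar> \<longleftrightarrow> \<bar>y i - y j\<bar> < \<bar>y i - y k\<bar>"
        using weakly_isotonic_perturbation[of Z "{1..M}" Y i j k, OF inj Z_free close I] N
        by (simp add: divide_less_cancel)
    qed
    show "delta_H (x ` {1..M}) {0..1} \<le> 1 / M"
    proof (subst delta_H_le_iff)
      show "\<forall>t\<in>{0..1}. \<exists>p\<in>x ` {1..M}. dist t p \<le> 1 / M"
      proof
        fix t :: real assume t: "t \<in> {0..1}"
        \<comment> \<open>The cell of length \<open>1 / M\<close> containing \<open>t\<close>; at
          \<open>t = 1\<close> the floor would give the index \<open>M\<close>, which is one too
          large.\<close>
        obtain i where "i < M" and i: "real i \<le> t * M" "t * M \<le> real i + 1"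
        proof (cases "t = 1")
          case True
          with \<open>M \<ge> 3\<close> show thesis by (intro that[of "M - 1"]) auto
        next
          case False
          then have "t * M < 1 * real M" using t \<open>M \<ge> 3\<close> by (intro mult_strict_right_mono) auto
          then show thesis
            using t by (intro that[of "nat \<lfloor>t * M\<rfloor>"]) (auto simp: nat_less_iff floor_less_iff)
        qed
        have "real i * L \<le> t * N" "t * N \<le> (real i + 1) * L"
          using mult_right_mono[OF i(1), of "real L"]
            mult_right_mono[OF i(2), of "real L"] by (simp_all add: N_def mult_ac)
        moreover have "real (i * L) \<le> real (X i)" "real (X i) \<le> real (Suc i * L)"
          using lower[of i] upper[of i] by (simp_all only: of_nat_le_iff less_imp_le)
        ultimately have "\<bar>t * N - X i\<bar> \<le> L"
          by (simp add: algebra_simps)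
        then have "\<bar>t * N - X i\<bar> / N \<le> L / N"
          using N by (simp add: divide_right_mono)
        moreover have "\<bar>t * N - X i\<bar> / N = \<bar>t - X i / N\<bar>"
        proof -
          have "\<bar>t * N - X i\<bar> / N = \<bar>(t * N - X i) / N\<bar>" using N by simp
          also have "(t * N - X i) / N = t - X i / N" using N by (simp add: field_simps)
          finally show ?thesis .
        qed
        moreover have "L / N = 1 / M"
          using \<open>L > 0\<close> by (simp add: N_def)
        ultimately have "dist t (x (Suc i)) \<le> 1 / M"
          by (simp add: x_def Z_def dist_real_def)
        with \<open>i < M\<close> show "\<exists>p\<in>x ` {1..M}. dist t p \<le> 1 / M"
          by (intro bexI[of _ "x (Suc i)"]) auto
      qed
    qed (use \<open>M \<ge> 3\<close> in auto)
  next
    fix A assume "similarity A"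
    then obtain l b where A: "A = (\<lambda>z. l * z + b)"
      by (auto simp: similarity_iff_affine)
    have "real (Z 1) < Z 2" "real (Z 2) + 1 \<le> Z M"
      using Z_mono[of 1 2] Z_mono[of 2 M] \<open>M \<ge> 3\<close> by auto
    then have "y 1 \<le> y 2" "y 2 \<le> y M"
      using N \<open>M \<ge> 3\<close> by (auto simp: y_def Y_def divide_right_mono)
    then have "\<bar>y 2 - x 2\<bar> / 2 \<le> d_infty M x (\<lambda>i. l * y i + b)"
      using \<open>M \<ge> 3\<close> by (intro d_infty_affine_ge[of 1 _ _ M]) (auto simp: x_def y_def Y_def)
    moreover have "\<bar>y 2 - x 2\<bar> / 2 = 1 / (16 * N)"
      using N by (simp add: x_def y_def Y_def add_divide_distrib)
    ultimately show "1 / (16 * (real M * L)) \<le> d_infty M x (\<lambda>i. A (y i))"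
      by (simp add: A N_def)
  qed
qed

subsection \<open>Choice of the parameters\<close>

text \<open>The numbers of points available later are \<open>2 ^ (m * (m + 1))\<close>. Here
  \<open>1 / \<alpha>\<close> is caught between two consecutive ones, at a place where
  \<open>P\<close> switches from false to true.\<close>

lemma between_powers_of_two:
  fixes \<alpha> :: real
  assumes "0 < \<alpha>" "\<alpha> < 1"
  obtains k :: nat where "\<alpha> * 2 ^ (k * (k + 1)) < 1" "1 \<le> \<alpha> * 2 ^ ((k + 1) * (k + 2))"
proof -
  define P where "P m \<longleftrightarrow> 1 \<le> \<alpha> * 2 ^ (m * (m + 1))" for m :: nat
  obtain m :: nat where "1 / \<alpha> < 2 ^ m"
    using real_arch_pow[of 2 "1 / \<alpha>"] by auto
  also have "(2::real) ^ m \<le> 2 ^ (m * (m + 1))"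
    by (intro power_increasing) auto
  finally have "P m"
    using assms by (simp add: P_def field_simps)
  moreover have "\<not> P 0" using assms by (simp add: P_def)
  ultimately obtain k where "\<not> P k" "P (Suc k)"
    using nat_induct[of "\<lambda>k. \<not> P k" m] by blast
  then show thesis by (intro that[of k]) (auto simp: P_def)
qed

lemma length_bound:
  fixes m :: nat
  shows "2 * (3 ^ m * (2 * m * (2 ^ m)\<^sup>2 + 1)) \<le> (2::real) * 36 ^ m"
proof -
  have "((2::real) ^ m)\<^sup>2 = 4 ^ m"
    by (simp add: power2_eq_square flip: power_mult_distrib)
  then have "2 * real m * (2 ^ m)\<^sup>2 + 1 \<le> (1 + real m * 2) * 4 ^ m"
    by (simp add: algebra_simps)
  also have "\<dots> \<le> 3 ^ m * 4 ^ m"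
    using Bernoulli_inequality[of 2 m] by (intro mult_right_mono) auto
  finally have "3 ^ m * (2 * real m * (2 ^ m)\<^sup>2 + 1) \<le> 3 ^ m * (3 ^ m * 4 ^ m)"
    by (intro mult_left_mono) auto
  also have "\<dots> = 36 ^ m" by (simp flip: power_mult_distrib)
  finally show ?thesis by (simp add: algebra_simps)
qed

text \<open>Bounding 144 by \<open>2 ^ 8\<close> and writing 32 as \<open>2 ^ 5\<close> leaves the
  exponent \<open>8 * k - 16 / \<epsilon>\<close>, since 13 = 5 + 8. Completing the square shows
  that \<open>16 / \<epsilon>\<close> suffices to make up for \<open>8 * k\<close> against
  \<open>\<epsilon> * k * k\<close>.\<close>

lemma exponential_le_gaussian:
  fixes \<epsilon> :: real and k :: nat
  assumes "\<epsilon> > 0"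
  shows "2 powr - (13 + 16 / \<epsilon>) * (32 * 144 ^ (k + 1)) \<le> 2 powr (\<epsilon> * (k * (k + 1)))"
proof -
  have "144 ^ (k + 1) \<le> (256::real) ^ (k + 1)" by (intro power_mono) auto
  also have "\<dots> = 2 powr (8 * (k + 1))"
    by (simp add: powr_realpow[symmetric] powr_powr[symmetric] powr_add)
  finally have "2 powr - (13 + 16 / \<epsilon>) * (32 * 144 ^ (k + 1))
      \<le> 2 powr - (13 + 16 / \<epsilon>) * (2 powr 5 * 2 powr (8 * (k + 1)))"
    by (intro mult_left_mono) auto
  also have "\<dots> = 2 powr (8 * k - 16 / \<epsilon>)"
    unfolding powr_add[symmetric] by (simp add: algebra_simps)
  also have "8 * k - 16 / \<epsilon> \<le> \<epsilon> * (k * (k + 1))"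
  proof -
    have "0 \<le> (\<epsilon> * k - 4)\<^sup>2 / \<epsilon>" using assms by simp
    also have "\<dots> = \<epsilon> * (k * k) - 8 * k + 16 / \<epsilon>"
      using assms by (simp add: power2_eq_square field_simps)
    also have "\<dots> \<le> \<epsilon> * (k * (k + 1)) - 8 * k + 16 / \<epsilon>"
      using assms by (simp add: algebra_simps)
    finally show ?thesis by simp
  qed
  finally show ?thesis by simp
qed

theorem proposition3:
  shows "\<exists>\<alpha>\<^sub>0 :: real. \<exists>c :: real \<Rightarrow> real.
    \<alpha>\<^sub>0 > 0 \<and> (\<forall>\<epsilon>>0. c \<epsilon> > 0) \<and>
    (\<forall>\<alpha>::real. 0 < \<alpha> \<and> \<alpha> < \<alpha>\<^sub>0 \<longrightarrow>
      (\<exists>(n::nat) (x :: nat \<Rightarrow> real) (y :: nat \<Rightarrow> real).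
        n \<ge> 1 \<and> distinct_tuple_in n {0..1} x \<and> distinct_tuple_in n {0..1} y \<and>
        delta_H (x ` {1..n}) {0..1} \<le> \<alpha> \<and>
        weakly_isotonic n x y \<and>
        (\<forall>A. similarity A \<longrightarrow>
          (\<forall>\<epsilon>>0. d_infty n x (\<lambda>i. A (y i)) \<ge> c \<epsilon> * \<alpha> powr (1 + \<epsilon>)))))"
proof (rule exI[of _ 1], rule exI[of _ "\<lambda>\<epsilon>. 2 powr - (13 + 16 / \<epsilon>)"], intro conjI allI impI)
  fix \<alpha> :: real assume \<alpha>: "0 < \<alpha> \<and> \<alpha> < 1"
  obtain k :: nat where k: "\<alpha> * 2 ^ (k * (k + 1)) < 1" "1 \<le> \<alpha> * 2 ^ ((k + 1) * (k + 2))"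
    using between_powers_of_two \<alpha> by blast
  \<comment> \<open>With \<open>e = 2 ^ m\<close> the exponent of \<open>M\<close> is quadratic in
    \<open>m\<close>, while \<open>L\<close> is at most \<open>2 * 36 ^ m\<close>; so
    \<open>L\<close> grows more slowly than any positive power of \<open>M\<close>.\<close>
  define m e where "m = k + 1" and "e = (2::nat) ^ m"
  define M where "M = (2 * e) ^ m"
  define L where "L = 2 * (3 ^ m * (2 * m * e\<^sup>2 + 1))"
  have M: "M = 2 ^ ((k + 1) * (k + 2))"
    by (simp add: M_def e_def m_def flip: power_Suc power_mult)
  have "(2::nat) ^ 2 \<le> M"
    unfolding M by (intro power_increasing) auto
  then have "M \<ge> 3" by simp
  have M_ge: "1 / M \<le> \<alpha>"
    using k(2) \<alpha> by (simp add: M field_simps)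
  \<comment> \<open>\<open>M\<close> may overshoot \<open>1 / \<alpha>\<close>, but only by the
    ratio \<open>4 ^ m\<close> of consecutive admissible values.\<close>
  have M_le: "M \<le> 4 ^ m / \<alpha>"
  proof -
    have "real M = 2 ^ (k * (k + 1)) * 2 ^ (2 * m)"
      by (simp add: M m_def flip: power_add)
    then have "\<alpha> * M = (\<alpha> * 2 ^ (k * (k + 1))) * 4 ^ m"
      by (simp add: power_mult)
    also have "\<dots> \<le> 1 * 4 ^ m"
      using k(1) by (intro mult_right_mono) auto
    finally show ?thesis using \<alpha> by (simp add: field_simps)
  qed
  have L_le: "L \<le> (2::real) * 36 ^ m"
    using length_bound[of m] by (simp add: L_def e_def)
  have "real M * L \<le> 4 ^ m / \<alpha> * (2 * 36 ^ m)"
    using M_le L_le \<alpha> by (intro mult_mono) auto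
  also have "\<dots> = 2 * 144 ^ m / \<alpha>"
    by (simp flip: power_mult_distrib)
  finally have N_le: "16 * (real M * L) \<le> 32 * 144 ^ m / \<alpha>" by simp
  have "e > 0" by (simp add: e_def)
  then obtain X where X: "\<And>n. n * L \<le> X n" "\<And>n. X n < Suc n * L"
    "\<And>i j k. \<lbrakk>i < M; j < M; k < M; X j + X k = 2 * X i\<rbrakk> \<Longrightarrow> j = k"
    using midpoint_free_sequence[of e m] unfolding L_def M_def by metis
  obtain x y where xy: "distinct_tuple_in M {0..1} x" "distinct_tuple_in M {0..1} y"
    "delta_H (x ` {1..M}) {0..1} \<le> 1 / M" "weakly_isotonic M x y"
    "\<And>A. similarity A \<Longrightarrow> d_infty M x (\<lambda>i. A (y i)) \<ge> 1 / (16 * (real M * L))"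
    by (rule exists_nonsimilar_weakly_isotonic_tuples[OF \<open>M \<ge> 3\<close> X]) iprover+
  have "L > 0" by (simp add: L_def)
  then have N_pos: "0 < real M * L" using \<open>M \<ge> 3\<close> by simp
  have bound: "2 powr - (13 + 16 / \<epsilon>) * \<alpha> powr (1 + \<epsilon>) \<le> 1 / (16 * (real M * L))"
    if "\<epsilon> > 0" for \<epsilon>
  proof -
    \<comment> \<open>The upper bound on \<alpha> lets \<open>\<alpha> powr \<epsilon>\<close>
      absorb the Gaussian factor, and with it the exponential loss
      \<open>32 * 144 ^ m\<close>.\<close>
    have "2 powr (\<epsilon> * (k * (k + 1))) * \<alpha> powr \<epsilon> = (\<alpha> * 2 ^ (k * (k + 1))) powr \<epsilon>"
      using \<alpha> by (simp add: powr_mult powr_realpow[symmetric] powr_powr mult_ac)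
    also have "\<dots> \<le> 1"
      using k(1) \<alpha> that by (intro powr_le1) auto
    finally have "2 powr - (13 + 16 / \<epsilon>) * (32 * 144 ^ m) * \<alpha> powr \<epsilon> \<le> 1"
      using mult_right_mono[OF exponential_le_gaussian[OF that, of k], of "\<alpha> powr \<epsilon>"]
      by (simp add: m_def)
    then have "2 powr - (13 + 16 / \<epsilon>) * \<alpha> powr \<epsilon> \<le> 1 / (32 * 144 ^ m)"
      by (simp add: field_simps)
    then have "2 powr - (13 + 16 / \<epsilon>) * \<alpha> powr \<epsilon> * \<alpha> \<le> 1 / (32 * 144 ^ m) * \<alpha>"
      using \<alpha> by (intro mult_right_mono) auto
    also have "\<dots> = 1 / (32 * 144 ^ m / \<alpha>)" by simp
    also have "\<dots> \<le> 1 / (16 * (real M * L))"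
      using N_le N_pos by (intro frac_le) auto
    finally show ?thesis
      using \<alpha> by (simp add: powr_add mult_ac)
  qed
  have "d_infty M x (\<lambda>i. A (y i)) \<ge> 2 powr - (13 + 16 / \<epsilon>) * \<alpha> powr (1 + \<epsilon>)"
    if "similarity A" "\<epsilon> > 0" for A \<epsilon>
    using xy(5)[OF that(1)] bound[OF that(2)] by linarith
  moreover have "delta_H (x ` {1..M}) {0..1} \<le> \<alpha>"
    using xy(3) M_ge by linarith
  moreover have "M \<ge> 1"
    using \<open>M \<ge> 3\<close> by simp
  ultimately show "\<exists>n x y. n \<ge> 1 \<and> distinct_tuple_in n {0..1} x \<and> distinct_tuple_in n {0..1} y \<and>
      delta_H (x ` {1..n}) {0..1} \<le> \<alpha> \<and> weakly_isotonic n x y \<and>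
      (\<forall>A. similarity A \<longrightarrow> (\<forall>\<epsilon>>0. d_infty n x (\<lambda>i. A (y i))
        \<ge> 2 powr - (13 + 16 / \<epsilon>) * \<alpha> powr (1 + \<epsilon>)))"
    using xy(1,2,4) by blast
qed simp_all

end
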